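(* Let $(\Omega,\mathcal D,\mathbb E)$ be a sublinear expectation space over a measurable space $(\Omega,\mathcal F)$ and let $\theta:\Omega\to\Omega$ be measurable. Assume $\mathbb E$ is regular, $\theta$-invariant (i.e. $\theta$ is expectation preserving) and has the representation as upper integrals. If the dynamical system $S=(\Omega,\mathcal D,\mathbb E,(\theta^n)_{n\in\mathbb N})$ is ergodic, then the strong law of large numbers holds: for every bounded measurable function $\xi$ there exists a constant $c$ such that $$\lim_{N\to\infty}\frac1N\sum_{n=0}^{N-1}\xi(\theta^n\omega)=c\quad\text{quasi-surely},$$ and this constant satisfies $c\in[-\mathbb E(-\xi),\mathbb E(\xi)]$.
   Context: $(\Omega,\mathcal F)$ is a measurable space and $\mathcal D$ is the linear space of all $\mathcal F$-measurable real-valued functions on $\Omega$. A sublinear expectation is a functional $\mathbb E:\mathcal D\to\mathbb R$ that is monotone ($X\ge Y\Rightarrow\mathbb E[X]\ge\mathbb E[Y]$), constant preserving ($\mathbb E[c]=c$ for $c\in\mathbb R$), sub-additive ($\mathbb E[X+Y]\le\mathbb E[X]+\mathbb E[Y]$) and positively homogeneous ($\mathbb E[\lambda X]=\lambda\mathbb E[X]$ for $\lambda\ge0$). The triple $(\Omega,\mathcal D,\mathbb E)$ is a sublinear expectation space. $\theta$ is expectation preserving if $\mathbb E[X\circ\theta]=\mathbb E[X]$ for all $X\in\mathcal D$. The system is ergodic if any $B\in\mathcal F$ with $\theta^{-1}B=B$ satisfies either $\mathbb E[I_B]=0$ or $\mathbb E[I_{B^c}]=0$. $\mathbb E$ is regular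 if for any $A_n\in\mathcal F$ with $A_n\downarrow\emptyset$ we have $\mathbb E[I_{A_n}]\downarrow0$. $\mathbb E$ has the representation as upper integrals if there is a family $\mathcal P$ of $\sigma$-additive probability measures on $(\Omega,\mathcal F)$ such that $\mathbb E[X]=\sup_{P\in\mathcal P}E_P[X]$. A statement holds quasi-surely if it holds for all $\omega\in\Omega\setminus A$ for some set $A$ with $\mathbb E[I_A]=0$. *)

theory Defs
  imports "HOL-Probability.Probability"
begin

text \<open>A measure \<open>M\<close> only carries the measurable space: \<open>\<Omega>\<close> is \<open>space M\<close>, the
  \<open>\<sigma>\<close>-algebra is \<open>sets M\<close>, and the measure that comes with \<open>M\<close> is never used. The domain of
  the expectation is \<open>borel_measurable M\<close>; pointwise conditions range over \<open>space M\<close> only, so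
  monotonicity makes \<open>E X\<close> independent of the values of \<open>X\<close> outside \<open>space M\<close>.\<close>

definition sublinear_expectation :: "'a measure \<Rightarrow> (('a \<Rightarrow> real) \<Rightarrow> real) \<Rightarrow> bool" where
  "sublinear_expectation M E \<longleftrightarrow>
     (\<forall>X\<in>borel_measurable M. \<forall>Y\<in>borel_measurable M.
        (\<forall>\<omega>\<in>space M. Y \<omega> \<le> X \<omega>) \<longrightarrow> E Y \<le> E X) \<and>
     (\<forall>c. E (\<lambda>\<omega>. c) = c) \<and>
     (\<forall>X\<in>borel_measurable M. \<forall>Y\<in>borel_measurable M. E (\<lambda>\<omega>. X \<omega> + Y \<omega>) \<le> E X + E Y) \<and>
     (\<forall>X\<in>borel_measurable M. \<forall>r\<ge>0. E (\<lambda>\<omega>. r * X \<omega>) = r * E X)"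

definition expectation_preserving ::
    "'a measure \<Rightarrow> (('a \<Rightarrow> real) \<Rightarrow> real) \<Rightarrow> ('a \<Rightarrow> 'a) \<Rightarrow> bool" where
  "expectation_preserving M E \<theta> \<longleftrightarrow> (\<forall>X\<in>borel_measurable M. E (X \<circ> \<theta>) = E X)"

definition ergodic_system ::
    "'a measure \<Rightarrow> (('a \<Rightarrow> real) \<Rightarrow> real) \<Rightarrow> ('a \<Rightarrow> 'a) \<Rightarrow> bool" where
  "ergodic_system M E \<theta> \<longleftrightarrow>
     (\<forall>B\<in>sets M. \<theta> -` B \<inter> space M = B \<longrightarrow>
        E (indicator B) = 0 \<or> E (indicator (space M - B)) = 0)"

definition regular_expectation :: "'a measure \<Rightarrow> (('a \<Rightarrow> real) \<Rightarrow> real) \<Rightarrow> bool" where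
  "regular_expectation M E \<longleftrightarrow>
     (\<forall>A :: nat \<Rightarrow> 'a set. range A \<subseteq> sets M \<longrightarrow> decseq A \<longrightarrow> (\<Inter>n. A n) = {} \<longrightarrow>
        decseq (\<lambda>n. E (indicator (A n))) \<and> (\<lambda>n. E (indicator (A n))) \<longlonglongrightarrow> 0)"

text \<open>The supremum is taken in \<open>ereal\<close>, so that it is a genuine supremum, and the family is forced
  to be nonempty since the empty supremum is \<open>-\<infinity>\<close>. The integrability clause only excludes
  the default value 0 of the Bochner integral. It does not restrict the mathematical notion: as
  \<open>\<bar>X\<bar>\<close> is in the domain and \<open>E\<close> is real-valued, every integral of \<open>\<bar>X\<bar>\<close> is at most
  \<open>E \<bar>X\<bar> < \<infinity>\<close>.\<close>

definition upper_integral_representation ::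
    "'a measure \<Rightarrow> (('a \<Rightarrow> real) \<Rightarrow> real) \<Rightarrow> bool" where
  "upper_integral_representation M E \<longleftrightarrow>
     (\<exists>\<P> :: 'a measure set.
        (\<forall>P\<in>\<P>. prob_space P \<and> sets P = sets M) \<and>
        (\<forall>X\<in>borel_measurable M.
           (\<forall>P\<in>\<P>. integrable P X) \<and>
           ereal (E X) = (SUP P\<in>\<P>. ereal (integral\<^sup>L P X))))"

definition quasi_surely ::
    "'a measure \<Rightarrow> (('a \<Rightarrow> real) \<Rightarrow> real) \<Rightarrow> ('a \<Rightarrow> bool) \<Rightarrow> bool" where
  "quasi_surely M E Q \<longleftrightarrow>
     (\<exists>A\<in>sets M. E (indicator A) = 0 \<and> (\<forall>\<omega>\<in>space M - A. Q \<omega>))"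

end

theory Submission
  imports Defs
begin

text \<open>For bounded \<open>\<xi>\<close> let \<open>S\<^sub>L\<close> denote the Birkhoff sums. By ergodicity the invariant functions
  \<open>limsup S\<^sub>L / L\<close> and \<open>limsup (- S\<^sub>L / L)\<close> are quasi-surely equal to constants \<open>c\<^sub>1\<close> and
  \<open>c\<^sub>2\<close>. If \<open>a < c\<^sub>1\<close>, quasi-every orbit contains stretches of average at least \<open>a\<close>; by
  regularity such a stretch of length at most \<open>N\<close> starts at every point outside a set of small
  capacity. Chopping \<open>{0..<L}\<close> greedily into such stretches, as in the Katznelson--Weiss proof of
  Birkhoff's theorem, gives a pointwise lower bound for \<open>S\<^sub>L\<close>, hence
  \<open>limsup E (- S\<^sub>L) / L \<le> - c\<^sub>1\<close>. Symmetrically \<open>limsup E (S\<^sub>L) / L \<le> - c\<^sub>2\<close>, and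
  \<open>0 \<le> E (S\<^sub>L) + E (- S\<^sub>L)\<close> forces \<open>c\<^sub>1 \<le> - c\<^sub>2\<close>, that is, convergence. No invariant
  probability measure below \<open>E\<close> is needed.\<close>

section \<open>Real sequences: greedy chopping into blocks, and shifted averages\<close>

text \<open>Greedy scan from \<open>m\<close>: an index that is not bad starts a block with
  nonnegative sum, which is skipped whole; a bad index is skipped alone at a cost of at most
  \<open>C\<close>. Once at most \<open>N\<close> terms remain, a block might overrun
  \<open>L\<close>, so they are bounded crudely by \<open>C * real N\<close>.\<close>

lemma greedy_block_lower_bound:
  fixes g :: "nat \<Rightarrow> real"
  assumes bound: "\<And>k. \<bar>g k\<bar> \<le> C"
    and blocks: "\<And>k. \<not> bad k \<Longrightarrow> \<exists>n\<in>{1..N}. 0 \<le> sum g {k..<k + n}"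
    and "m \<le> L"
  shows "- C * (\<Sum>k=m..<L. of_bool (bad k)) - C * real N \<le> sum g {m..<L}"
  using \<open>m \<le> L\<close>
proof (induction "L - m" arbitrary: m rule: less_induct)
  case less
  have C: "0 \<le> C"
    using bound[of 0] by linarith
  have nonneg: "0 \<le> C * (\<Sum>k=m..<L. of_bool (bad k))"
    by (intro mult_nonneg_nonneg C sum_nonneg) auto
  consider "L - m \<le> N" | "N < L - m" "bad m" | "N < L - m" "\<not> bad m"
    by linarith
  then show ?case
  proof cases
    case 1
    have "- (C * real (L - m)) \<le> sum g {m..<L}"
      using sum_bounded_below[of "{m..<L}" "- C" g] bound
      by (simp add: abs_le_iff minus_le_iff mult.commute)
    moreover have "C * real (L - m) \<le> C * real N"
      using 1 C by (intro mult_left_mono) auto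
    ultimately show ?thesis
      using nonneg by linarith
  next
    case 2
    then have "m < L" by linarith
    then have "- C * (\<Sum>k=Suc m..<L. of_bool (bad k)) - C * real N \<le> sum g {Suc m..<L}"
      by (intro less.hyps) auto
    moreover have "- C \<le> g m"
      using bound[of m] by linarith
    ultimately show ?thesis
      using \<open>m < L\<close> \<open>bad m\<close> by (simp add: sum.atLeast_Suc_lessThan algebra_simps del: sum_of_bool_eq)
  next
    case 3
    then obtain n where n: "1 \<le> n" "n \<le> N" "0 \<le> sum g {m..<m + n}"
      using blocks[of m] by auto
    then have le: "m \<le> m + n" "m + n \<le> L"
      using 3 by linarith+
    have "- C * (\<Sum>k=m + n..<L. of_bool (bad k)) - C * real N \<le> sum g {m + n..<L}"
      using n le 3 by (intro less.hyps) auto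
    moreover have "0 \<le> C * (\<Sum>k=m..<m + n. of_bool (bad k))"
      by (intro mult_nonneg_nonneg C sum_nonneg) auto
    moreover have "C * (\<Sum>k=m..<L. of_bool (bad k)) =
        C * (\<Sum>k=m..<m + n. of_bool (bad k)) + C * (\<Sum>k=m + n..<L. of_bool (bad k))"
      by (simp only: distrib_left[symmetric] sum.atLeastLessThan_concat[OF le])
    ultimately show ?thesis
      using n(3) sum.atLeastLessThan_concat[OF le, of g] by linarith
  qed
qed

text \<open>Gives the invariance under \<theta> of the upper limit of the averages: the average of
  \<open>N + 1\<close> terms of \<open>f\<close> is that of \<open>N\<close> terms of the shifted
  sequence times \<open>N / (N + 1)\<close>, plus the vanishing term
  \<open>f 0 / (N + 1)\<close>.\<close>

lemma limsup_average_Suc: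
  fixes f :: "nat \<Rightarrow> real"
  shows "limsup (\<lambda>N. ereal (1 / real N * (\<Sum>n<N. f (Suc n)))) =
    limsup (\<lambda>N. ereal (1 / real N * (\<Sum>n<N. f n)))"
proof -
  let ?a = "\<lambda>N. 1 / real N * (\<Sum>n<N. f n)" and ?b = "\<lambda>N. 1 / real N * (\<Sum>n<N. f (Suc n))"
  have "limsup (\<lambda>N. ereal (?a N)) = limsup (\<lambda>N. ereal (?a (N + 1)))"
    by (rule limsup_shift[symmetric])
  also have "\<dots> = limsup (\<lambda>N. ereal (f 0 / real (N + 1)) + ereal (real N / real (N + 1)) * ereal (?b N))"
  proof (intro arg_cong[of _ _ limsup] ext)
    fix N :: nat
    show "ereal (?a (N + 1)) = ereal (f 0 / real (N + 1)) + ereal (real N / real (N + 1)) * ereal (?b N)"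
      \<comment> \<open>For \<open>N = 0\<close> the factor \<open>real N\<close> does not cancel
        against \<open>1 / real N\<close>, which is 0; both sides are then
        \<open>f 0\<close>.\<close>
      by (cases "N = 0") (simp_all add: sum.lessThan_Suc_shift add_divide_distrib del: sum.lessThan_Suc)
  qed
  also have "\<dots> = ereal 0 + limsup (\<lambda>N. ereal (real N / real (N + 1)) * ereal (?b N))"
  proof (rule ereal_limsup_lim_add)
    show "(\<lambda>N. ereal (f 0 / real (N + 1))) \<longlonglongrightarrow> ereal 0"
      using LIMSEQ_Suc[OF lim_const_over_n[of "f 0"]] by simp
  qed simp
  also have "limsup (\<lambda>N. ereal (real N / real (N + 1)) * ereal (?b N)) = ereal 1 * limsup (\<lambda>N. ereal (?b N))"
  proof (rule ereal_limsup_lim_mult)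
    show "(\<lambda>N. ereal (real N / real (N + 1))) \<longlonglongrightarrow> ereal 1"
      using LIMSEQ_n_over_Suc_n[where 'a=real] by simp
  qed auto
  finally show ?thesis
    by simp
qed

section \<open>Sublinear expectations and their null sets\<close>

locale sublinear_space =
  fixes M :: "'a measure" and E :: "('a \<Rightarrow> real) \<Rightarrow> real"
  assumes sublinear: "sublinear_expectation M E"
    and representation: "upper_integral_representation M E"
begin

lemma E_mono:
  "X \<in> borel_measurable M \<Longrightarrow> Y \<in> borel_measurable M \<Longrightarrow>
    (\<And>\<omega>. \<omega> \<in> space M \<Longrightarrow> Y \<omega> \<le> X \<omega>) \<Longrightarrow> E Y \<le> E X"
  using sublinear unfolding sublinear_expectation_def by blast

lemma E_const: "E (\<lambda>\<omega>. c) = c"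
  using sublinear unfolding sublinear_expectation_def by blast

lemma E_add:
  "X \<in> borel_measurable M \<Longrightarrow> Y \<in> borel_measurable M \<Longrightarrow> E (\<lambda>\<omega>. X \<omega> + Y \<omega>) \<le> E X + E Y"
  using sublinear unfolding sublinear_expectation_def by blast

lemma E_scale: "X \<in> borel_measurable M \<Longrightarrow> 0 \<le> r \<Longrightarrow> E (\<lambda>\<omega>. r * X \<omega>) = r * E X"
  using sublinear unfolding sublinear_expectation_def by blast

lemma E_sum:
  assumes "\<And>i. i \<in> I \<Longrightarrow> X i \<in> borel_measurable M"
  shows "E (\<lambda>\<omega>. \<Sum>i\<in>I. X i \<omega>) \<le> (\<Sum>i\<in>I. E (X i))"
  using assms
proof (induction I rule: infinite_finite_induct)
  case (insert i I)
  have "E (\<lambda>\<omega>. X i \<omega> + (\<Sum>j\<in>I. X j \<omega>)) \<le> E (X i) + E (\<lambda>\<omega>. \<Sum>j\<in>I. X j \<omega>)"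
    using insert.prems by (intro E_add borel_measurable_sum) auto
  also have "\<dots> \<le> E (X i) + (\<Sum>j\<in>I. E (X j))"
    using insert by auto
  finally show ?case
    using insert.hyps by simp
qed (simp_all add: E_const)

text \<open>Turns upper bounds for the expectations of Birkhoff sums and of their negatives into
  inequalities between constants.\<close>

lemma E_uminus_ge:
  assumes "X \<in> borel_measurable M"
  shows "0 \<le> E X + E (\<lambda>\<omega>. - X \<omega>)"
  using E_add[of X "\<lambda>\<omega>. - X \<omega>"] assms by (simp add: E_const)

lemma capacity_nonneg: "A \<in> sets M \<Longrightarrow> 0 \<le> E (indicator A)"
  using E_mono[of "indicator A" "\<lambda>_. 0"] by (simp add: E_const)

lemma capacity_empty: "E (indicator {}) = 0"
  using E_const[of 0] by (simp add: indicator_def[abs_def])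

text \<open>Ensures that a null set never exhausts \<open>space M\<close>, so that quasi-sure
  statements can be evaluated at a point.\<close>

lemma capacity_space: "E (indicator (space M)) = 1"
proof (rule antisym)
  show "E (indicator (space M)) \<le> 1"
    using E_mono[of "\<lambda>_. 1" "indicator (space M)"] by (simp add: E_const)
  show "1 \<le> E (indicator (space M))"
    using E_mono[of "indicator (space M)" "\<lambda>_. 1"] by (simp add: E_const)
qed

text \<open>Each \<open>P\<close> of the representing family gives \<open>A i\<close> measure at
  most \<open>E (indicator (A i)) = 0\<close>, so \<sigma>-additivity makes the union
  \<open>P\<close>-null; the supremum over the family is then at most 0.\<close>

lemma null_UN:
  fixes A :: "'i :: countable \<Rightarrow> 'a set"
  assumes sets: "\<And>i. A i \<in> sets M" and null: "\<And>i. E (indicator (A i)) = 0"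
  shows "E (indicator (\<Union>i. A i)) = 0"
proof -
  obtain \<P> where family: "\<forall>P\<in>\<P>. prob_space P \<and> sets P = sets M"
    and sup: "\<forall>X\<in>borel_measurable M. (\<forall>P\<in>\<P>. integrable P X) \<and>
      ereal (E X) = (SUP P\<in>\<P>. ereal (integral\<^sup>L P X))"
    using representation unfolding upper_integral_representation_def by (elim exE conjE) (rule that)
  note \<P> = bspec[OF family] and rep = conjunct2[OF bspec[OF sup]]
  have le: "integral\<^sup>L P (indicator (\<Union>i. A i)) \<le> (0 :: real)" if "P \<in> \<P>" for P
  proof -
    interpret prob_space P
      using \<P>[OF that] by simp
    have sets_P: "A i \<in> sets P" for i
      using \<P>[OF that] sets by simp
    have "measure P (A i) = 0" for i
    proof -
      have "ereal (integral\<^sup>L P (indicator (A i))) \<le> ereal (E (indicator (A i)))"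
        unfolding rep[OF borel_measurable_indicator[OF sets]] by (rule SUP_upper[OF that])
      then show ?thesis
        using sets.sets_into_space[OF sets_P, of i]
        by (simp add: null Int_absorb2 measure_le_0_iff)
    qed
    then have "(\<Union>i. A i) \<in> null_sets P"
      using sets_P by (intro null_sets_UN) (auto simp: null_sets_def emeasure_eq_measure)
    then have "(\<Union>i. A i) \<inter> space P \<in> null_sets P"
      by (rule null_set_Int2) simp
    then show ?thesis
      by (simp add: measure_eq_0_null_sets)
  qed
  have UN: "(\<Union>i. A i) \<in> sets M"
    using sets by (intro sets.countable_UN'') auto
  have "ereal (E (indicator (\<Union>i. A i))) \<le> ereal 0"
    unfolding rep[OF borel_measurable_indicator[OF UN]] using le by (intro SUP_least) simp
  then show ?thesis
    using capacity_nonneg[OF UN] by simp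
qed

lemma null_Un:
  assumes "A \<in> sets M" "B \<in> sets M" "E (indicator A) = 0" "E (indicator B) = 0"
  shows "E (indicator (A \<union> B)) = 0"
  using null_UN[of "\<lambda>b. if b then A else B"] assms by (simp add: UNIV_bool Un_commute)

lemma null_subset:
  assumes "A \<in> sets M" "B \<in> sets M" "B \<subseteq> A" "E (indicator A) = 0"
  shows "E (indicator B) = 0"
proof -
  have "E (indicator B) \<le> E (indicator A)"
    using assms by (intro E_mono) (auto split: split_indicator)
  then show ?thesis
    using capacity_nonneg[of B] assms by simp
qed

end

section \<open>Birkhoff sums under an invariant sublinear expectation\<close>

locale ergodic_sublinear_system = sublinear_space +
  fixes \<theta> :: "'a \<Rightarrow> 'a"
  assumes theta [measurable]: "\<theta> \<in> measurable M M"
    and regular: "regular_expectation M E"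
    and preserving: "expectation_preserving M E \<theta>"
    and ergodic: "ergodic_system M E \<theta>"
begin

lemma theta_iterate [measurable]: "(\<theta> ^^ n) \<in> measurable M M"
  by (rule measurable_compose_n[OF theta])

lemma theta_iterate_space: "\<omega> \<in> space M \<Longrightarrow> (\<theta> ^^ n) \<omega> \<in> space M"
  by (rule measurable_space[OF theta_iterate])

lemma E_iterate:
  assumes "X \<in> borel_measurable M"
  shows "E (\<lambda>\<omega>. X ((\<theta> ^^ n) \<omega>)) = E X"
proof (induction n)
  case (Suc n)
  have "E ((\<lambda>\<omega>. X ((\<theta> ^^ n) \<omega>)) \<circ> \<theta>) = E (\<lambda>\<omega>. X ((\<theta> ^^ n) \<omega>))"
    using preserving measurable_compose[OF theta_iterate assms]
    unfolding expectation_preserving_def by blast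
  then show ?case
    using Suc by (simp add: comp_def funpow_swap1)
qed simp

definition birkhoff :: "('a \<Rightarrow> real) \<Rightarrow> nat \<Rightarrow> 'a \<Rightarrow> real" where
  "birkhoff \<xi> L \<omega> = (\<Sum>n<L. \<xi> ((\<theta> ^^ n) \<omega>))"

lemma birkhoff_measurable [measurable]:
  "\<xi> \<in> borel_measurable M \<Longrightarrow> birkhoff \<xi> L \<in> borel_measurable M"
  unfolding birkhoff_def[abs_def]
  by (intro borel_measurable_sum measurable_compose[OF theta_iterate])

lemma birkhoff_uminus: "birkhoff (\<lambda>\<omega>. - \<xi> \<omega>) L \<omega> = - birkhoff \<xi> L \<omega>"
  by (simp add: birkhoff_def sum_negf)

lemma E_birkhoff:
  assumes "\<xi> \<in> borel_measurable M"
  shows "E (birkhoff \<xi> L) \<le> real L * E \<xi>"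
  using E_sum[of "{..<L}" "\<lambda>n \<omega>. \<xi> ((\<theta> ^^ n) \<omega>)"] assms
  by (simp add: birkhoff_def[abs_def] E_iterate)

lemma birkhoff_iterate:
  "birkhoff \<xi> n ((\<theta> ^^ k) \<omega>) = (\<Sum>i=k..<k + n. \<xi> ((\<theta> ^^ i) \<omega>))"
  using sum.shift_bounds_nat_ivl[of "\<lambda>i. \<xi> ((\<theta> ^^ i) \<omega>)" 0 k n]
  by (simp add: birkhoff_def atLeast0LessThan funpow_add add.commute)

text \<open>By regularity, a block of average at least \<open>a\<close> and length at most
  \<open>N\<close> starts at every point outside a set \<open>Z N\<close> of small capacity.
  Chopping orbits into such blocks bounds \<open>- birkhoff \<xi> L\<close> by
  \<open>- a * real L\<close>, up to the visits to \<open>Z N\<close> and a term independent of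
  \<open>L\<close>; by invariance the visits cost at most \<open>\<delta> * real L\<close>.\<close>

lemma E_birkhoff_uminus_le:
  assumes [measurable]: "\<xi> \<in> borel_measurable M"
    and bound: "\<And>\<omega>. \<omega> \<in> space M \<Longrightarrow> \<bar>\<xi> \<omega>\<bar> \<le> B"
    and above: "quasi_surely M E (\<lambda>\<omega>. \<exists>n>0. a * real n \<le> birkhoff \<xi> n \<omega>)"
    and "0 < \<delta>"
  shows "\<exists>K. \<forall>L. E (\<lambda>\<omega>. - birkhoff \<xi> L \<omega>) \<le> (\<delta> - a) * real L + K"
proof -
  \<comment> \<open>\<open>C\<close> bounds the distance of \<xi> from \<open>a\<close> on
    \<open>space M\<close>; the summand 1 keeps it positive for the division
    \<open>\<delta> / C\<close>.\<close>
  define C where "C = \<bar>B\<bar> + \<bar>a\<bar> + 1"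
  have C: "0 < C"
    unfolding C_def by linarith
  define Z where "Z N = {\<omega>\<in>space M. \<forall>n\<in>{1..N}. birkhoff \<xi> n \<omega> < a * real n}" for N
  have Z [measurable]: "Z N \<in> sets M" for N
    unfolding Z_def by measurable
  obtain A where A [measurable]: "A \<in> sets M" and null: "E (indicator A) = 0"
    and good: "\<And>\<omega>. \<omega> \<in> space M - A \<Longrightarrow> \<exists>n>0. a * real n \<le> birkhoff \<xi> n \<omega>"
    using above unfolding quasi_surely_def by blast
  \<comment> \<open>Points of the exceptional set \<open>A\<close> may stay in \<open>Z N\<close>
    for every \<open>N\<close>; once \<open>A\<close> is removed, the sets decrease to the empty set
    and regularity applies.\<close>
  have "(\<lambda>N. E (indicator (Z N - A))) \<longlonglongrightarrow> 0"
  proof -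
    have "decseq (\<lambda>N. Z N - A)"
      unfolding decseq_def Z_def by fastforce
    moreover have "(\<Inter>N. Z N - A) = {}"
    proof (intro equals0I)
      fix \<omega> assume *: "\<omega> \<in> (\<Inter>N. Z N - A)"
      then have "\<omega> \<in> space M - A"
        by (auto simp: Z_def)
      then obtain n where "n > 0" "a * real n \<le> birkhoff \<xi> n \<omega>"
        using good by blast
      moreover have "\<omega> \<in> Z n"
        using * by (rule INT_E) auto
      then have "birkhoff \<xi> n \<omega> < a * real n"
        using \<open>0 < n\<close> unfolding Z_def by simp
      ultimately show False
        by simp
    qed
    moreover have "range (\<lambda>N. Z N - A) \<subseteq> sets M"
      by auto
    ultimately show ?thesis
      using regular unfolding regular_expectation_def by blast
  qed
  then have "eventually (\<lambda>N. E (indicator (Z N - A)) < \<delta> / C) sequentially"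
    using \<open>0 < \<delta>\<close> C by (intro order_tendstoD) auto
  then obtain N where N: "E (indicator (Z N - A)) < \<delta> / C"
    by (auto simp: eventually_sequentially)
  \<comment> \<open>Sub-additivity puts the null set \<open>A\<close> back at no cost.\<close>
  have "E (indicator (Z N)) \<le> E (\<lambda>\<omega>. indicator (Z N - A) \<omega> + indicator A \<omega>)"
    by (intro E_mono) (auto split: split_indicator)
  also have "\<dots> \<le> E (indicator (Z N - A)) + E (indicator A)"
    by (intro E_add) auto
  also have "\<dots> \<le> \<delta> / C"
    using N null by simp
  finally have cap: "C * E (indicator (Z N)) \<le> \<delta>"
    using C by (simp add: field_simps)
  let ?I = "indicator (Z N) :: 'a \<Rightarrow> real"
  have pointwise: "- birkhoff \<xi> L \<omega> \<le> C * birkhoff ?I L \<omega> + (C * real N - a * real L)"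
    if "\<omega> \<in> space M" for L \<omega>
  proof -
    \<comment> \<open>The greedy bound is applied to \<xi> minus \<open>a\<close> along the orbit,
      so that a block of average at least \<open>a\<close> has nonnegative sum; the bad times are
      the visits to \<open>Z N\<close>.\<close>
    have "- C * (\<Sum>k=0..<L. of_bool ((\<theta> ^^ k) \<omega> \<in> Z N)) - C * real N
        \<le> (\<Sum>k=0..<L. \<xi> ((\<theta> ^^ k) \<omega>) - a)"
    proof (rule greedy_block_lower_bound)
      fix k
      have in_space: "(\<theta> ^^ k) \<omega> \<in> space M"
        using that by (rule theta_iterate_space)
      show "\<bar>\<xi> ((\<theta> ^^ k) \<omega>) - a\<bar> \<le> C"
        using bound[OF in_space] unfolding C_def by linarith
      assume "(\<theta> ^^ k) \<omega> \<notin> Z N"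
      then obtain n where "n \<in> {1..N}" "a * real n \<le> birkhoff \<xi> n ((\<theta> ^^ k) \<omega>)"
        using in_space by (auto simp: Z_def not_less)
      then show "\<exists>n\<in>{1..N}. 0 \<le> (\<Sum>i=k..<k + n. \<xi> ((\<theta> ^^ i) \<omega>) - a)"
        by (intro bexI[of _ n]) (simp_all add: birkhoff_iterate sum_subtractf mult.commute)
    qed simp
    then show ?thesis
      by (simp add: birkhoff_def sum_subtractf atLeast0LessThan indicator_def of_bool_def
          algebra_simps)
  qed
  have "E (\<lambda>\<omega>. - birkhoff \<xi> L \<omega>) \<le> (\<delta> - a) * real L + C * real N" for L
  proof -
    have "E (\<lambda>\<omega>. - birkhoff \<xi> L \<omega>)
        \<le> E (\<lambda>\<omega>. C * birkhoff ?I L \<omega> + (C * real N - a * real L))"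
      by (intro E_mono pointwise) auto
    also have "\<dots> \<le> E (\<lambda>\<omega>. C * birkhoff ?I L \<omega>) + E (\<lambda>\<omega>. C * real N - a * real L)"
      by (intro E_add) auto
    also have "\<dots> = C * E (birkhoff ?I L) + (C * real N - a * real L)"
      using C by (simp add: E_scale E_const)
    \<comment> \<open>\<open>birkhoff ?I L\<close> counts the visits to \<open>Z N\<close> before
      time \<open>L\<close>.\<close>
    also have "\<dots> \<le> C * (real L * E ?I) + (C * real N - a * real L)"
      using C by (intro add_right_mono mult_left_mono E_birkhoff) auto
    also have "\<dots> \<le> \<delta> * real L + (C * real N - a * real L)"
      using mult_right_mono[OF cap, of "real L"] by (simp add: ac_simps)
    finally show ?thesis
      by (simp add: algebra_simps)
  qed
  then show ?thesis
    by blast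
qed

section \<open>Ergodicity: invariant functions and upper limits of averages\<close>

text \<open>Sublevel sets of \<open>g\<close> are invariant, so each of them or its complement is
  null. The constant is the level at which this switches, and countably many rational levels
  separate every other value of \<open>g\<close> from it. In \<open>ereal\<close> the supremum
  defining this level always exists.\<close>

lemma invariant_quasi_surely_const:
  fixes g :: "'a \<Rightarrow> ereal"
  assumes [measurable]: "g \<in> borel_measurable M"
    and invariant: "\<And>\<omega>. \<omega> \<in> space M \<Longrightarrow> g (\<theta> \<omega>) = g \<omega>"
  shows "\<exists>c. quasi_surely M E (\<lambda>\<omega>. g \<omega> = c)"
proof -
  let ?low = "\<lambda>a. {\<omega>\<in>space M. g \<omega> < a}"
  let ?up = "\<lambda>a. {\<omega>\<in>space M. a \<le> g \<omega>}"
  define c where "c = Sup {a. E (indicator (?low a)) = 0}"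
  have dichotomy: "E (indicator (?low a)) = 0 \<or> E (indicator (?up a)) = 0" for a
  proof -
    have "\<theta> -` ?low a \<inter> space M = ?low a"
      using invariant measurable_space[OF theta] by auto
    moreover have "?low a \<in> sets M"
      by measurable
    moreover have "space M - ?low a = ?up a"
      by auto
    ultimately show ?thesis
      using ergodic unfolding ergodic_system_def by metis
  qed
  have low: "E (indicator (?low a)) = 0" if a: "a < c" for a
  proof -
    obtain b where "E (indicator (?low b)) = 0" "a < b"
      using a unfolding c_def less_Sup_iff by blast
    then show ?thesis
      by (intro null_subset[of "?low b" "?low a"]) (measurable, auto)
  qed
  have up: "E (indicator (?up a)) = 0" if "c < a" for a
  proof -
    have "E (indicator (?low a)) \<noteq> 0"
      using that Sup_upper[of a "{a. E (indicator (?low a)) = 0}"] unfolding c_def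
      by (auto simp: not_less[symmetric])
    then show ?thesis
      using dichotomy by blast
  qed
  \<comment> \<open>Each rational level contributes whichever set is null by \<open>low\<close> or
    \<open>up\<close>; a level equal to \<open>c\<close> contributes nothing.\<close>
  define A where "A q = (if ereal (of_rat q) < c then ?low (ereal (of_rat q))
    else if c < ereal (of_rat q) then ?up (ereal (of_rat q)) else {})" for q
  have A [measurable]: "A q \<in> sets M" for q
    by (simp add: A_def)
  have "E (indicator (A q)) = 0" for q
    using low up by (simp add: A_def capacity_empty)
  then have "E (indicator (\<Union>q. A q)) = 0"
    by (intro null_UN A)
  moreover have "(\<Union>q. A q) \<in> sets M"
    by measurable
  moreover have "g \<omega> = c" if \<omega>: "\<omega> \<in> space M - (\<Union>q. A q)" for \<omega>
  proof (rule ccontr)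
    assume "g \<omega> \<noteq> c"
    then consider "g \<omega> < c" | "c < g \<omega>"
      by (meson linorder_neqE)
    then show False
    proof cases
      case 1
      then obtain q where "g \<omega> < ereal (of_rat q)" "ereal (of_rat q) < c"
        using ereal_dense3 by blast
      then have "\<omega> \<in> A q"
        using DiffD1[OF \<omega>] by (simp add: A_def)
      then show False
        using that by blast
    next
      case 2
      then obtain q where q: "c < ereal (of_rat q)" "ereal (of_rat q) < g \<omega>"
        using ereal_dense3 by blast
      then have "\<omega> \<in> A q"
        using q(1) less_not_sym[OF q(1)] DiffD1[OF \<omega>] by (simp add: A_def less_imp_le)
      then show False
        using that by blast
    qed
  qed
  ultimately show ?thesis
    unfolding quasi_surely_def by (intro exI[of _ c] bexI[of _ "\<Union>q. A q"] conjI ballI)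
qed

text \<open>Boundedness makes the constant finite: it is the value of the upper limit at any one
  point outside the null set, where all averages lie between \<open>- \<bar>B\<bar>\<close> and
  \<open>\<bar>B\<bar>\<close>.\<close>

lemma limsup_birkhoff_quasi_surely_const:
  assumes [measurable]: "\<xi> \<in> borel_measurable M"
    and bound: "\<And>\<omega>. \<omega> \<in> space M \<Longrightarrow> \<bar>\<xi> \<omega>\<bar> \<le> B"
  shows "\<exists>c. quasi_surely M E
    (\<lambda>\<omega>. limsup (\<lambda>N. ereal (1 / real N * birkhoff \<xi> N \<omega>)) = ereal c)"
proof -
  let ?g = "\<lambda>\<omega>. limsup (\<lambda>N. ereal (1 / real N * birkhoff \<xi> N \<omega>))"
  have "?g (\<theta> \<omega>) = ?g \<omega>" for \<omega>
    using limsup_average_Suc[of "\<lambda>n. \<xi> ((\<theta> ^^ n) \<omega>)"]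
    by (simp add: birkhoff_def funpow_swap1)
  then obtain c where "quasi_surely M E (\<lambda>\<omega>. ?g \<omega> = c)"
    using invariant_quasi_surely_const[of ?g] by auto
  then obtain A where A: "A \<in> sets M" "E (indicator A) = 0"
    and c: "\<And>\<omega>. \<omega> \<in> space M - A \<Longrightarrow> ?g \<omega> = c"
    unfolding quasi_surely_def by blast
  have "A \<noteq> space M"
    using A capacity_space by auto
  then obtain \<omega> where \<omega>: "\<omega> \<in> space M - A"
    using sets.sets_into_space[OF A(1)] by blast
  have avg: "\<bar>1 / real N * birkhoff \<xi> N \<omega>\<bar> \<le> \<bar>B\<bar>" for N
  proof -
    have "\<bar>birkhoff \<xi> N \<omega>\<bar> \<le> (\<Sum>n<N. \<bar>\<xi> ((\<theta> ^^ n) \<omega>)\<bar>)"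
      unfolding birkhoff_def by (rule sum_abs)
    also have "\<dots> \<le> real N * \<bar>B\<bar>"
      using sum_bounded_above[of "{..<N}" "\<lambda>n. \<bar>\<xi> ((\<theta> ^^ n) \<omega>)\<bar>" "\<bar>B\<bar>"] bound \<omega>
        theta_iterate_space by (simp add: order.trans[OF _ abs_ge_self])
    finally show ?thesis
      by (cases "N = 0") (simp_all add: abs_mult field_simps)
  qed
  have "?g \<omega> \<le> ereal \<bar>B\<bar>"
    using avg by (intro Limsup_bounded always_eventually allI) (simp only: ereal_less_eq abs_le_D1)
  moreover have "ereal (- \<bar>B\<bar>) \<le> ?g \<omega>"
  proof (rule order.trans)
    show "ereal (- \<bar>B\<bar>) \<le> liminf (\<lambda>N. ereal (1 / real N * birkhoff \<xi> N \<omega>))"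
    proof (intro Liminf_bounded always_eventually allI)
      show "ereal (- \<bar>B\<bar>) \<le> ereal (1 / real N * birkhoff \<xi> N \<omega>)" for N
        using avg[of N] by (simp only: ereal_less_eq minus_le_iff abs_le_D2)
    qed
  qed (simp add: Liminf_le_Limsup)
  ultimately have "c = ereal (real_of_ereal c)"
    using c[OF \<omega>] by (cases c) auto
  then show ?thesis
    using A c unfolding quasi_surely_def by metis
qed

text \<open>An upper limit \<open>c\<close> forces some average of at least
  \<open>c - \<delta> / 2\<close>; the other half of \<delta> is spent in
  \<open>E_birkhoff_uminus_le\<close>.\<close>

lemma E_birkhoff_uminus_le_limsup:
  assumes "\<xi> \<in> borel_measurable M"
    and "\<And>\<omega>. \<omega> \<in> space M \<Longrightarrow> \<bar>\<xi> \<omega>\<bar> \<le> B"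
    and lim: "quasi_surely M E
      (\<lambda>\<omega>. limsup (\<lambda>N. ereal (1 / real N * birkhoff \<xi> N \<omega>)) = ereal c)"
    and "0 < \<delta>"
  shows "\<exists>K. \<forall>L. E (\<lambda>\<omega>. - birkhoff \<xi> L \<omega>) \<le> (\<delta> - c) * real L + K"
proof -
  have above: "\<exists>n>0. (c - \<delta> / 2) * real n \<le> birkhoff \<xi> n \<omega>"
    if "limsup (\<lambda>N. ereal (1 / real N * birkhoff \<xi> N \<omega>)) = ereal c" for \<omega>
  proof (rule ccontr)
    assume "\<not> ?thesis"
    then have "birkhoff \<xi> n \<omega> < (c - \<delta> / 2) * real n" if "0 < n" for n
      using that by (meson not_le)
    then have "1 / real n * birkhoff \<xi> n \<omega> \<le> c - \<delta> / 2" if "0 < n" for n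
      using that by (simp add: pos_divide_le_eq less_imp_le)
    \<comment> \<open>The average at \<open>N = 0\<close> is 0 by the convention for division, so
      the bound is claimed for positive \<open>N\<close> only.\<close>
    then have "limsup (\<lambda>N. ereal (1 / real N * birkhoff \<xi> N \<omega>)) \<le> ereal (c - \<delta> / 2)"
      by (intro Limsup_bounded eventually_mono[OF eventually_gt_at_top[of 0]]) simp
    then show False
      using that \<open>0 < \<delta>\<close> by simp
  qed
  have "quasi_surely M E (\<lambda>\<omega>. \<exists>n>0. (c - \<delta> / 2) * real n \<le> birkhoff \<xi> n \<omega>)"
    using lim above unfolding quasi_surely_def by meson
  then show ?thesis
    using E_birkhoff_uminus_le[of \<xi> B "c - \<delta> / 2" "\<delta> / 2"] assms by simp
qed

section \<open>Comparison of growth rates and the strong law\<close>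

text \<open>Discards the additive constants of the estimates on Birkhoff sums, leaving an inequality
  between their linear rates.\<close>

lemma linear_bound_nonneg:
  fixes s K :: real
  assumes "\<And>L :: nat. 0 \<le> s * real L + K"
  shows "0 \<le> s"
proof (rule ccontr)
  assume "\<not> ?thesis"
  then obtain L :: nat where "K < real L * (- s)"
    using reals_Archimedean3[of "- s"] by auto
  then show False
    using assms[of L] by (simp add: mult.commute)
qed

theorem strong_law:
  assumes \<xi> [measurable]: "\<xi> \<in> borel_measurable M"
    and bound: "\<And>\<omega>. \<omega> \<in> space M \<Longrightarrow> \<bar>\<xi> \<omega>\<bar> \<le> B"
  shows "\<exists>c. quasi_surely M E (\<lambda>\<omega>. (\<lambda>N. 1 / real N * birkhoff \<xi> N \<omega>) \<longlonglongrightarrow> c) \<and>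
    c \<in> {- E (\<lambda>\<omega>. - \<xi> \<omega>) .. E \<xi>}"
proof -
  let ?\<eta> = "\<lambda>\<omega>. - \<xi> \<omega>"
  have \<eta>: "?\<eta> \<in> borel_measurable M" "\<And>\<omega>. \<omega> \<in> space M \<Longrightarrow> \<bar>?\<eta> \<omega>\<bar> \<le> B"
    using bound by auto
  obtain c where c: "quasi_surely M E
      (\<lambda>\<omega>. limsup (\<lambda>N. ereal (1 / real N * birkhoff \<xi> N \<omega>)) = ereal c)"
    using limsup_birkhoff_quasi_surely_const[OF \<xi> bound] by blast
  obtain d where d: "quasi_surely M E
      (\<lambda>\<omega>. limsup (\<lambda>N. ereal (1 / real N * birkhoff ?\<eta> N \<omega>)) = ereal d)"
    using limsup_birkhoff_quasi_surely_const[OF \<eta>] by blast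
  \<comment> \<open>Stated for a general \<zeta> because \<xi> yields the upper end of the interval
    and \<open>?\<eta>\<close> the lower one. The rates \<open>E \<zeta>\<close> and
    \<open>\<delta> - e\<close>, which bound the growth of the expectations of the sums and of their
    negatives, must have a nonnegative sum.\<close>
  have le_E: "e \<le> E \<zeta>" if \<zeta>: "\<zeta> \<in> borel_measurable M" and \<zeta>_bound: "\<And>\<omega>. \<omega> \<in> space M \<Longrightarrow> \<bar>\<zeta> \<omega>\<bar> \<le> B"
    and \<zeta>_lim: "quasi_surely M E
      (\<lambda>\<omega>. limsup (\<lambda>N. ereal (1 / real N * birkhoff \<zeta> N \<omega>)) = ereal e)"
    for \<zeta> e
  proof (rule field_le_epsilon)
    fix \<delta> :: real assume "0 < \<delta>"
    then obtain K where K: "\<And>L. E (\<lambda>\<omega>. - birkhoff \<zeta> L \<omega>) \<le> (\<delta> - e) * real L + K"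
      using E_birkhoff_uminus_le_limsup[OF \<zeta> \<zeta>_bound \<zeta>_lim] by blast
    have "0 \<le> (E \<zeta> + \<delta> - e) * real L + K" for L
      using E_uminus_ge[of "birkhoff \<zeta> L"] E_birkhoff[of \<zeta> L] K[of L] \<zeta>
      by (simp add: algebra_simps)
    then show "e \<le> E \<zeta> + \<delta>"
      using linear_bound_nonneg[of "E \<zeta> + \<delta> - e" K] by simp
  qed
  have "c \<le> - d"
  proof (rule field_le_epsilon)
    fix \<delta> :: real assume "0 < \<delta>"
    then have half: "0 < \<delta> / 2" by simp
    obtain K where K: "\<And>L. E (\<lambda>\<omega>. - birkhoff \<xi> L \<omega>) \<le> (\<delta> / 2 - c) * real L + K"
      using E_birkhoff_uminus_le_limsup[OF \<xi> bound c half] by blast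
    \<comment> \<open>The negated Birkhoff sums of \<open>?\<eta>\<close> are those of \<xi>, so the
      estimate for \<open>?\<eta>\<close> bounds \<open>E (birkhoff \<xi> L)\<close> from
      above.\<close>
    obtain K' where K': "\<And>L. E (birkhoff \<xi> L) \<le> (\<delta> / 2 - d) * real L + K'"
      using E_birkhoff_uminus_le_limsup[OF \<eta> d half] by (auto simp: birkhoff_uminus)
    have "0 \<le> (\<delta> - c - d) * real L + (K + K')" for L
      using E_uminus_ge[of "birkhoff \<xi> L"] K[of L] K'[of L] by (simp add: algebra_simps)
    then show "c \<le> - d + \<delta>"
      using linear_bound_nonneg[of "\<delta> - c - d" "K + K'"] by simp
  qed
  obtain A where A: "A \<in> sets M" "E (indicator A) = 0"
    and A_lim: "\<And>\<omega>. \<omega> \<in> space M - A \<Longrightarrow>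
      limsup (\<lambda>N. ereal (1 / real N * birkhoff \<xi> N \<omega>)) = ereal c"
    using c unfolding quasi_surely_def by blast
  obtain A' where A': "A' \<in> sets M" "E (indicator A') = 0"
    and A'_lim: "\<And>\<omega>. \<omega> \<in> space M - A' \<Longrightarrow>
      limsup (\<lambda>N. ereal (1 / real N * birkhoff ?\<eta> N \<omega>)) = ereal d"
    using d unfolding quasi_surely_def by blast
  have liminf: "liminf (\<lambda>N. ereal (1 / real N * birkhoff \<xi> N \<omega>)) = ereal (- d)"
    if "\<omega> \<in> space M - (A \<union> A')" for \<omega>
    using A'_lim[of \<omega>] that ereal_Liminf_uminus[of sequentially "\<lambda>N. ereal (1 / real N * birkhoff ?\<eta> N \<omega>)"]
    by (simp add: birkhoff_uminus)
  have null: "E (indicator (A \<union> A')) = 0"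
    by (rule null_Un) fact+
  then have "A \<union> A' \<noteq> space M"
    using capacity_space by auto
  \<comment> \<open>The remaining inequality between the constants, lower limit at most upper limit,
    is read off at a single point.\<close>
  then obtain \<omega>\<^sub>0 where \<omega>\<^sub>0: "\<omega>\<^sub>0 \<in> space M - (A \<union> A')"
    using sets.sets_into_space[OF A(1)] sets.sets_into_space[OF A'(1)] by blast
  have "ereal (- d) \<le> ereal c"
    using Liminf_le_Limsup[of sequentially "\<lambda>N. ereal (1 / real N * birkhoff \<xi> N \<omega>\<^sub>0)"]
      liminf[OF \<omega>\<^sub>0] A_lim[of \<omega>\<^sub>0] \<omega>\<^sub>0 by simp
  with \<open>c \<le> - d\<close> have "d = - c"
    by simp
  have "(\<lambda>N. 1 / real N * birkhoff \<xi> N \<omega>) \<longlonglongrightarrow> c" if "\<omega> \<in> space M - (A \<union> A')" for \<omega>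
  proof -
    have "(\<lambda>N. ereal (1 / real N * birkhoff \<xi> N \<omega>)) \<longlonglongrightarrow> ereal c"
      using liminf[OF that] A_lim[of \<omega>] that \<open>d = - c\<close>
      by (intro Liminf_eq_Limsup) auto
    then show ?thesis
      unfolding lim_ereal .
  qed
  then have "quasi_surely M E (\<lambda>\<omega>. (\<lambda>N. 1 / real N * birkhoff \<xi> N \<omega>) \<longlonglongrightarrow> c)"
    using null A A' unfolding quasi_surely_def by blast
  moreover have "c \<le> E \<xi>" "- E ?\<eta> \<le> c"
    using le_E[OF \<xi> bound c] le_E[OF \<eta> d] \<open>d = - c\<close> by auto
  ultimately show ?thesis
    by auto
qed

end

theorem theorem2p14:
  fixes M :: "'a measure" and E :: "('a \<Rightarrow> real) \<Rightarrow> real" and \<theta> :: "'a \<Rightarrow> 'a"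
  assumes "sublinear_expectation M E"
    and "\<theta> \<in> measurable M M"
    and "regular_expectation M E"
    and "expectation_preserving M E \<theta>"
    and "upper_integral_representation M E"
    and "ergodic_system M E \<theta>"
  shows "\<forall>\<xi> :: 'a \<Rightarrow> real. \<xi> \<in> borel_measurable M \<and> bounded (\<xi> ` space M) \<longrightarrow>
           (\<exists>c :: real.
              quasi_surely M E
                (\<lambda>\<omega>. (\<lambda>N. 1 / real N * (\<Sum>n<N. \<xi> ((\<theta> ^^ n) \<omega>))) \<longlonglongrightarrow> c) \<and>
              c \<in> {- E (\<lambda>\<omega>. - \<xi> \<omega>) .. E \<xi>})"
proof (intro allI impI)
  fix \<xi> :: "'a \<Rightarrow> real"
  assume \<xi>: "\<xi> \<in> borel_measurable M \<and> bounded (\<xi> ` space M)"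
  interpret ergodic_sublinear_system M E \<theta>
    using assms by unfold_locales
  obtain B where "\<And>\<omega>. \<omega> \<in> space M \<Longrightarrow> \<bar>\<xi> \<omega>\<bar> \<le> B"
    using \<xi> unfolding bounded_iff by auto
  then show "\<exists>c :: real.
      quasi_surely M E (\<lambda>\<omega>. (\<lambda>N. 1 / real N * (\<Sum>n<N. \<xi> ((\<theta> ^^ n) \<omega>))) \<longlonglongrightarrow> c) \<and>
      c \<in> {- E (\<lambda>\<omega>. - \<xi> \<omega>) .. E \<xi>}"
    using strong_law[of \<xi> B] \<xi> unfolding birkhoff_def by blast
qed

end
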